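(* Let $\Gamma$ be a finite simple connected graph with discriminant $P$ and boundary matrix $d$, let $x,y$ be vertices of $\Gamma$, and let $\tau$ be a nonnegative integer. If perfect state transfer occurs (in the Grover walk on $\Gamma$) from $d^*\boldsymbol{e}_x$ to $d^*\boldsymbol{e}_y$ at time $\tau$, then $T_{\tau}(\lambda)\in\{1,-1\}$ for every $\lambda\in\Theta_{P}(\boldsymbol{e}_x)$.
   Context: Let $\Gamma=(V,E)$ be a finite simple connected graph with at least two vertices. Let $\mathcal{A}=\{(x,y),(y,x)\mid \{x,y\}\in E\}$ be its set of symmetric arcs. For $a=(x,y)\in\mathcal{A}$ the origin is $o(a)=x$, the terminus is $t(a)=y$, and the inverse arc is $a^{-1}=(y,x)$. Write $\delta$ for the Kronecker delta and $M^*$ for the conjugate transpose of $M$. Define: - the boundary matrix $d\in\mathbb{C}^{V\times\mathcal{A}}$ by $d_{x,a}=\frac{1}{\sqrt{\deg x}}\,\delta_{x,t(a)}$; - the shift matrix $S\in\mathbb{C}^{\mathcal{A}\times\mathcal{A}}$ by $S_{a,b}=\delta_{a,b^{-1}}$; - the time evolution matrix of the Grover walk $U=S(2d^*d-I)\in\mathbb{C}^{\mathcal{A}\times\mathcal{A}}$; - the discriminant $P=dSd^*\in\mathbb{C}^{V\times V}$ (a real symmetric matrix). For $x\in V$, $\boldsymbol{e}_x\in\mathbb{C}^V$ is the unit vector with $(\boldsymbol{e}_x)_z=\delta_{x,z}$. A vector $\Phi\in\mathbb{C}^{\mathcal{A}}$ is a state if $\|\Phi\|=1$. Perfect state transfer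 occurs from a state $\Phi$ to a state $\Psi$ at time $\tau$ if there is $\gamma\in\mathbb{C}$ with $|\gamma|=1$ such that $U^{\tau}\Phi=\gamma\Psi$. The Chebyshev polynomials of the first kind are defined by $T_0(x)=1$, $T_1(x)=x$, $T_n(x)=2xT_{n-1}(x)-T_{n-2}(x)$ for $n\ge 2$. For a normal matrix $M\in\mathbb{C}^{n\times n}$ with spectral decomposition $M=\sum_{i=1}^s\lambda_iE_i$ ($\lambda_1,\dots,\lambda_s$ the distinct eigenvalues, $E_i$ the orthogonal projection onto the $\lambda_i$-eigenspace), $\sigma(M)=\{\lambda_1,\dots,\lambda_s\}$ and the eigenvalue support of $v\in\mathbb{C}^n$ with respect to $M$ is $\Theta_M(v)=\{\lambda_i\in\sigma(M)\mid E_iv\neq 0\}$. *)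

theory Defs
  imports "HOL-Analysis.Analysis" "Graph_Theory.Graph_Theory"
begin

section \<open>Complex matrices indexed by finite types\<close>

text \<open>Powers are iterated matrix products, because \<open>^\<close> on vectors and matrices is the
  entrywise power.\<close>

primrec matrix_power :: "complex^'n^'n \<Rightarrow> nat \<Rightarrow> complex^'n^'n" where
  "matrix_power M 0 = mat 1"
| "matrix_power M (Suc k) = M ** matrix_power M k"

definition conj_transpose :: "complex^'n^'m \<Rightarrow> complex^'m^'n" where
  "conj_transpose M = (\<chi> i j. cnj (M $ j $ i))"

text \<open>The library's \<open>\<bullet>\<close> on complex vectors is only the real part of this Hermitian form.\<close>

definition herm_inner :: "complex^'n \<Rightarrow> complex^'n \<Rightarrow> complex" where
  "herm_inner v w = (\<Sum>i\<in>UNIV. v $ i * cnj (w $ i))"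

definition matrix_spectrum :: "complex^'n^'n \<Rightarrow> complex set" where
  "matrix_spectrum M = {\<mu>. \<exists>v. v \<noteq> 0 \<and> M *v v = \<mu> *s v}"

definition eigenspace :: "complex^'n^'n \<Rightarrow> complex \<Rightarrow> (complex^'n) set" where
  "eigenspace M \<mu> = {v. M *v v = \<mu> *s v}"

text \<open>For a complex subspace \<open>W\<close> the vector described below exists and is unique; the lemma
  \<open>orth_projection_eigenspace\<close> establishes this for eigenspaces.\<close>

definition orth_projection :: "(complex^'n) set \<Rightarrow> complex^'n \<Rightarrow> complex^'n" where
  "orth_projection W v = (THE w. w \<in> W \<and> (\<forall>u\<in>W. herm_inner (v - w) u = 0))"

definition eigenvalue_support :: "complex^'n^'n \<Rightarrow> complex^'n \<Rightarrow> complex set" where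
  "eigenvalue_support M v =
     {\<mu> \<in> matrix_spectrum M. orth_projection (eigenspace M \<mu>) v \<noteq> 0}"

lemma orth_projection_eigenspace_ex1:
  "\<exists>!w. w \<in> eigenspace M \<mu> \<and> (\<forall>u\<in>eigenspace M \<mu>. herm_inner (v - w) u = 0)"
proof -
  let ?W = "eigenspace M \<mu>"
  have scale: "c *s w \<in> ?W" if "w \<in> ?W" for c w
    using that unfolding eigenspace_def
    by (simp add: vector_scalar_commute mult.commute)
  have diff: "w - w' \<in> ?W" if "w \<in> ?W" "w' \<in> ?W" for w w'
    using that unfolding eigenspace_def
    by (simp add: matrix_vector_mult_diff_distrib vector_ssub_ldistrib)
  have scaleR: "r *\<^sub>R w = complex_of_real r *s w" for r and w :: "complex^'n"
    by (simp add: vec_eq_iff) (simp add: scaleR_conv_of_real)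
  have "subspace ?W"
  proof (rule subspaceI)
    show "0 \<in> ?W" by (simp add: eigenspace_def)
    show "a + b \<in> ?W" if "a \<in> ?W" "b \<in> ?W" for a b
      using that unfolding eigenspace_def
      by (simp add: matrix_vector_right_distrib vector_add_ldistrib)
    show "r *\<^sub>R a \<in> ?W" if "a \<in> ?W" for r a
      using scale[OF that] by (simp add: scaleR)
  qed
  then have span: "span ?W = ?W" by (rule span_eq_iff[THEN iffD2])
  obtain y z where y: "y \<in> ?W" and z: "\<And>w. w \<in> ?W \<Longrightarrow> orthogonal z w" and v: "v = y + z"
    using orthogonal_subspace_decomp_exists[of ?W v] unfolding span by metis
  have Re: "Re (herm_inner a b) = a \<bullet> b" for a b :: "complex^'n"
    by (simp add: herm_inner_def inner_vec_def inner_complex_def)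
  have Im: "Re (herm_inner a (\<i> *s b)) = Im (herm_inner a b)" for a b :: "complex^'n"
    by (simp add: herm_inner_def algebra_simps)
  have zero: "herm_inner z w = 0" if "w \<in> ?W" for w
  proof (rule complex_eqI)
    show "Re (herm_inner z w) = Re 0"
      using z[OF that] by (simp add: Re orthogonal_def)
    show "Im (herm_inner z w) = Im 0"
      using z[OF scale[OF that, of \<i>]] by (simp add: Im[symmetric] Re orthogonal_def)
  qed
  show ?thesis
  proof (rule ex1I[of _ y])
    show "y \<in> ?W \<and> (\<forall>u\<in>?W. herm_inner (v - y) u = 0)"
      using y zero v by simp
    fix w assume w: "w \<in> ?W \<and> (\<forall>u\<in>?W. herm_inner (v - w) u = 0)"
    have yw: "y - w \<in> ?W" using diff y w by blast
    have "herm_inner (y - w) (y - w) = herm_inner (v - w) (y - w) - herm_inner z (y - w)"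
      unfolding v by (simp add: herm_inner_def algebra_simps sum_subtractf sum.distrib)
    also have "\<dots> = 0" using w yw zero by simp
    finally have "(y - w) \<bullet> (y - w) = 0" by (simp add: Re[symmetric])
    then show "w = y" by simp
  qed
qed

lemma orth_projection_eigenspace:
  "orth_projection (eigenspace M \<mu>) v \<in> eigenspace M \<mu>"
  "u \<in> eigenspace M \<mu> \<Longrightarrow> herm_inner (v - orth_projection (eigenspace M \<mu>) v) u = 0"
  using theI'[OF orth_projection_eigenspace_ex1[of M \<mu> v]]
  unfolding orth_projection_def by blast+

section \<open>Grover walks\<close>

text \<open>A finite simple graph is given, as in \<open>Graph_Theory\<close>, by its digraph of symmetric arcs: in
  the locale \<open>graph\<close> there are no loops and no parallel arcs, and every arc has an inverse arc.
  The origin and the terminus of an arc are its \<open>tail\<close> and its \<open>head\<close>. Vertices and arcs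
  exhaust the types \<open>'v\<close> and \<open>'a\<close>, so that \<open>complex^'v\<close> and \<open>complex^'a\<close> are
  the spaces of complex vectors indexed by the vertices and by the arcs. As an edge joins two
  distinct vertices, a connected graph with at least two vertices has an arc, so it is no
  restriction that the type \<open>'a\<close> is inhabited.\<close>

definition simple_connected_graph :: "('v::finite, 'a::finite) pre_digraph \<Rightarrow> bool" where
  "simple_connected_graph G \<longleftrightarrow>
     graph G \<and> verts G = UNIV \<and> arcs G = UNIV \<and> Digraph_Component.connected G"

definition inv_arc :: "('v, 'a) pre_digraph \<Rightarrow> 'a \<Rightarrow> 'a" where
  "inv_arc G a = (THE b. b \<in> arcs G \<and> tail G b = head G a \<and> head G b = tail G a)"

definition vertex_degree :: "('v, 'a) pre_digraph \<Rightarrow> 'v \<Rightarrow> nat" where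
  "vertex_degree G x = card {y. x \<rightarrow>\<^bsub>G\<^esub> y}"

definition boundary_matrix :: "('v::finite, 'a::finite) pre_digraph \<Rightarrow> complex^'a^'v" where
  "boundary_matrix G =
     (\<chi> x a. complex_of_real (1 / sqrt (real (vertex_degree G x))) * (if x = head G a then 1 else 0))"

definition shift_matrix :: "('v::finite, 'a::finite) pre_digraph \<Rightarrow> complex^'a^'a" where
  "shift_matrix G = (\<chi> a b. if a = inv_arc G b then 1 else 0)"

definition grover_matrix :: "('v::finite, 'a::finite) pre_digraph \<Rightarrow> complex^'a^'a" where
  "grover_matrix G =
     shift_matrix G **
       (2 *\<^sub>R (conj_transpose (boundary_matrix G) ** boundary_matrix G) - mat 1)"

definition discriminant :: "('v::finite, 'a::finite) pre_digraph \<Rightarrow> complex^'v^'v" where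
  "discriminant G =
     boundary_matrix G ** shift_matrix G ** conj_transpose (boundary_matrix G)"

definition is_state :: "complex^'a \<Rightarrow> bool" where
  "is_state \<Phi> \<longleftrightarrow> norm \<Phi> = 1"

definition perfect_state_transfer ::
  "('v::finite, 'a::finite) pre_digraph \<Rightarrow> complex^'a \<Rightarrow> complex^'a \<Rightarrow> nat \<Rightarrow> bool" where
  "perfect_state_transfer G \<Phi> \<Psi> \<tau> \<longleftrightarrow>
     is_state \<Phi> \<and> is_state \<Psi> \<and>
     (\<exists>\<gamma>::complex. norm \<gamma> = 1 \<and> matrix_power (grover_matrix G) \<tau> *v \<Phi> = \<gamma> *s \<Psi>)"

lemma (in graph) inv_arc:
  assumes "a \<in> arcs G"
  shows "inv_arc G a \<in> arcs G" "tail G (inv_arc G a) = head G a" "head G (inv_arc G a) = tail G a"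
proof -
  obtain b where b: "b \<in> arcs G" "tail G b = head G a" "head G b = tail G a"
    using assms sym_arcs unfolding symmetric_conv by metis
  have "\<exists>!b. b \<in> arcs G \<and> tail G b = head G a \<and> head G b = tail G a"
    using b by (intro ex1I[of _ b]) (auto intro!: no_multi_arcs simp: arc_to_ends_def)
  from theI'[OF this]
  show "inv_arc G a \<in> arcs G" "tail G (inv_arc G a) = head G a" "head G (inv_arc G a) = tail G a"
    unfolding inv_arc_def by auto
qed

lemma (in graph) vertex_degree_eq_in_degree: "vertex_degree G x = in_degree G x"
proof -
  have "inj_on (tail G) (in_arcs G x)"
    by (auto intro!: inj_onI no_multi_arcs simp: arc_to_ends_def)
  moreover have "tail G ` in_arcs G x = {y. x \<rightarrow>\<^bsub>G\<^esub> y}"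
    using graph_symmetric by (fastforce simp: arcs_ends_conv image_iff)
  ultimately show ?thesis
    unfolding vertex_degree_def in_degree_def by (metis card_image)
qed

lemma vertex_degree_pos:
  fixes G :: "('v::finite, 'a::finite) pre_digraph"
  assumes "simple_connected_graph G" "2 \<le> CARD('v)"
  shows "0 < vertex_degree G x"
proof -
  interpret graph G using assms(1) by (simp add: simple_connected_graph_def)
  have V: "verts G = UNIV" using assms(1) by (simp add: simple_connected_graph_def)
  obtain y where y: "y \<noteq> x"
  proof -
    have "\<not> UNIV \<subseteq> {x}" using assms(2) card_mono[of "{x}" "UNIV :: 'v set"] by auto
    then show thesis using that by auto
  qed
  have "strongly_connected G"
    using assms(1) reachable_mk_symmetric_eq[OF sym_arcs]
    by (auto simp: simple_connected_graph_def Digraph_Component.connected_def strongly_connected_def)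
  then have "x \<rightarrow>\<^sup>*\<^bsub>G\<^esub> y" by (auto simp: strongly_connected_def V)
  then obtain w where "x \<rightarrow>\<^bsub>G\<^esub> w" using y by (metis converse_reachable_cases)
  then show ?thesis unfolding vertex_degree_def by (auto simp: card_gt_0_iff)
qed

lemma is_state_conj_transpose_boundary:
  fixes G :: "('v::finite, 'a::finite) pre_digraph"
  assumes "simple_connected_graph G" "2 \<le> CARD('v)"
  shows "is_state (conj_transpose (boundary_matrix G) *v axis x 1)" (is "is_state ?\<Phi>")
proof -
  interpret graph G using assms(1) by (simp add: simple_connected_graph_def)
  have A: "arcs G = UNIV" using assms(1) by (simp add: simple_connected_graph_def)
  have column: "(M *v axis x 1) $ a = M $ a $ x" for M :: "complex^'v^'a" and a
    by (simp add: matrix_vector_mult_def axis_def if_distrib[of "\<lambda>c. _ * c"] cong: if_cong)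
  have nth: "?\<Phi> $ a =
      (if x = head G a then complex_of_real (1 / sqrt (real (vertex_degree G x))) else 0)" for a
    by (simp add: column conj_transpose_def boundary_matrix_def)
  have "(\<Sum>a\<in>UNIV. (norm (?\<Phi> $ a))\<^sup>2)
      = (\<Sum>a\<in>UNIV. if x = head G a then 1 / real (vertex_degree G x) else 0)"
    by (intro sum.cong) (auto simp: nth norm_divide power_divide)
  also have "\<dots> = (\<Sum>a\<in>in_arcs G x. 1 / real (vertex_degree G x))"
    by (rule sum.mono_neutral_cong_right) (auto simp: A)
  also have "\<dots> = 1"
    using vertex_degree_pos[OF assms, of x]
    by (auto simp: vertex_degree_eq_in_degree in_degree_def card_gt_0_iff)
  finally show ?thesis by (simp add: is_state_def norm_vec_def L2_set_def)
qed

section \<open>Chebyshev polynomials of the first kind\<close>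

fun chebyshev_T :: "nat \<Rightarrow> 'b::comm_ring_1 \<Rightarrow> 'b" where
  "chebyshev_T 0 x = 1"
| "chebyshev_T (Suc 0) x = x"
| "chebyshev_T (Suc (Suc n)) x = 2 * x * chebyshev_T (Suc n) x - chebyshev_T n x"

end

theory Submission
  imports Defs
begin

text \<open>The Grover walk is \<open>U = S R\<close> with two involutions: the shift \<open>S\<close> and the reflection
  \<open>R = 2 d\<^sup>* d - I\<close> in the range of \<open>d\<^sup>*\<close>. Two consequences carry the proof.

  First, \<open>U\<close> is reversible: \<open>U R U = R\<close>, hence \<open>U\<^sup>\<tau> R U\<^sup>\<tau> = R\<close> (\<open>walk_power_reversal\<close>). As \<open>R\<close>
  fixes the range of \<open>d\<^sup>*\<close>, transfer \<open>U\<^sup>\<tau> d\<^sup>* e\<^sub>x = \<gamma> d\<^sup>* e\<^sub>y\<close> entails the transfer back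
  \<open>\<gamma> U\<^sup>\<tau> d\<^sup>* e\<^sub>y = d\<^sup>* e\<^sub>x\<close> (\<open>transfer_back\<close>). The two phases cancel on the round trip from
  \<open>x\<close> to \<open>y\<close> and back.

  Second, \<open>d U\<^sup>n d\<^sup>* = T\<^sub>n(P)\<close>, because \<open>d U\<^sup>n\<close> obeys the recurrence of the Chebyshev
  polynomials (\<open>boundary_walk_recurrence\<close>). So \<open>T\<^sub>\<tau>(P) e\<^sub>x = \<gamma> e\<^sub>y\<close> and
  \<open>\<gamma> T\<^sub>\<tau>(P) e\<^sub>y = e\<^sub>x\<close>, and \<open>T\<^sub>\<tau>(P)\<^sup>2\<close> fixes \<open>e\<^sub>x\<close>.

  Let \<open>w \<noteq> 0\<close> be the projection of \<open>e\<^sub>x\<close> to the eigenspace of \<open>\<mu>\<close>. Then the Hermitian form of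
  \<open>e\<^sub>x\<close> with \<open>w\<close> is that of \<open>w\<close> with itself, so it is not zero. As \<open>P\<close> is Hermitian, applying
  \<open>T\<^sub>\<tau>(P)\<close> to the first argument multiplies the form by the conjugate of \<open>T\<^sub>\<tau>(\<mu>)\<close>
  (\<open>herm_inner_walk\<close>). Doing so twice gives \<open>T\<^sub>\<tau>(\<mu>)\<^sup>2 = 1\<close>.\<close>

lemma herm_inner_diff_left: "herm_inner (u - v) w = herm_inner u w - herm_inner v w"
  by (simp add: herm_inner_def algebra_simps sum_subtractf)

lemma herm_inner_scale_left: "herm_inner (c *s v) w = c * herm_inner v w"
  by (simp add: herm_inner_def sum_distrib_left mult.assoc)

lemma herm_inner_scale_right: "herm_inner v (c *s w) = cnj c * herm_inner v w"
  by (simp add: herm_inner_def sum_distrib_left mult_ac)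

lemma herm_inner_self_eq_0_iff: "herm_inner w w = 0 \<longleftrightarrow> w = 0"
proof
  assume "herm_inner w w = 0"
  then have "Re (herm_inner w w) = 0" by simp
  then have "w \<bullet> w = 0"
    by (simp add: herm_inner_def inner_vec_def inner_complex_def)
  then show "w = 0" by simp
qed (simp add: herm_inner_def)

lemma herm_inner_mult_left:
  "herm_inner (M *v v) w = herm_inner v (conj_transpose M *v w)"
proof -
  have "herm_inner (M *v v) w = (\<Sum>i\<in>UNIV. \<Sum>j\<in>UNIV. M $ i $ j * v $ j * cnj (w $ i))"
    by (simp add: herm_inner_def matrix_vector_mult_def sum_distrib_right)
  also have "\<dots> = (\<Sum>j\<in>UNIV. \<Sum>i\<in>UNIV. M $ i $ j * v $ j * cnj (w $ i))"
    by (rule sum.swap)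
  also have "\<dots> = herm_inner v (conj_transpose M *v w)"
    by (simp add: herm_inner_def matrix_vector_mult_def conj_transpose_def
        sum_distrib_left mult_ac)
  finally show ?thesis .
qed

lemma herm_inner_orth_projection_eigenspace:
  "herm_inner v (orth_projection (eigenspace M \<mu>) v) =
     herm_inner (orth_projection (eigenspace M \<mu>) v) (orth_projection (eigenspace M \<mu>) v)"
  using orth_projection_eigenspace(2)[OF orth_projection_eigenspace(1), of v M \<mu>]
  by (simp add: herm_inner_diff_left)

lemma conj_transpose_mult:
  "conj_transpose (A ** B) = conj_transpose B ** conj_transpose A"
  by (simp add: conj_transpose_def matrix_matrix_mult_def vec_eq_iff mult.commute)

lemma conj_transpose_conj_transpose: "conj_transpose (conj_transpose M) = M"
  by (simp add: conj_transpose_def vec_eq_iff)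

lemma matrix_power_Suc_right: "matrix_power M (Suc n) = matrix_power M n ** M"
  by (induction n) (simp_all add: matrix_mul_assoc)

lemma cnj_chebyshev_T: "cnj (chebyshev_T n \<mu>) = chebyshev_T n (cnj \<mu>)"
  by (induction n \<mu> rule: chebyshev_T.induct) simp_all

text \<open>The argument uses of the graph only that \<open>d\<close> is a coisometry and that \<open>S\<close> is a
  self-adjoint involution.\<close>

locale involutive_walk =
  fixes d :: "complex^'a::finite^'v::finite" and S :: "complex^'a^'a"
  assumes coisometry: "d ** conj_transpose d = mat 1"
    and involution: "S ** S = mat 1"
    and self_adjoint: "conj_transpose S = S"
begin

abbreviation reflection :: "complex^'a^'a" where
  "reflection \<equiv> 2 *\<^sub>R (conj_transpose d ** d) - mat 1"

abbreviation walk :: "complex^'a^'a" where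
  "walk \<equiv> S ** reflection"

abbreviation disc :: "complex^'v^'v" where
  "disc \<equiv> d ** S ** conj_transpose d"

lemma disc_self_adjoint: "conj_transpose disc = disc"
  by (simp add: conj_transpose_mult conj_transpose_conj_transpose self_adjoint matrix_mul_assoc)

lemma coisometry_vec: "d *v (conj_transpose d *v v) = v"
  by (simp add: matrix_vector_mul_assoc coisometry)

lemma involution_vec: "S *v (S *v f) = f"
  by (simp add: matrix_vector_mul_assoc involution)

lemma reflection_vec: "reflection *v f = 2 *s (conj_transpose d *v (d *v f)) - f"
proof -
  have "(2 *\<^sub>R M) *v f = 2 *s (M *v f)" for M :: "complex^'a^'a"
    by (simp add: matrix_vector_mult_def vec_eq_iff sum_distrib_left scaleR_conv_of_real mult.assoc)
  then show ?thesis
    by (simp add: matrix_vector_mult_diff_rdistrib matrix_vector_mul_assoc)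
qed

lemma reflection_fixes_range: "reflection *v (conj_transpose d *v v) = conj_transpose d *v v"
  by (simp add: reflection_vec coisometry_vec vec_eq_iff)

lemma boundary_reflection: "d *v (reflection *v f) = d *v f"
  by (simp add: reflection_vec matrix_vector_mult_diff_distrib vector_scalar_commute
      coisometry_vec vec_eq_iff)

lemma reflection_involution: "reflection *v (reflection *v f) = f"
proof -
  have "reflection *v (reflection *v f)
      = 2 *s (conj_transpose d *v (d *v (reflection *v f))) - reflection *v f"
    by (rule reflection_vec)
  also have "\<dots> = f"
    unfolding boundary_reflection by (simp add: reflection_vec)
  finally show ?thesis .
qed

lemma walk_vec: "walk *v f = S *v (reflection *v f)"
  by (simp only: matrix_vector_mul_assoc)

lemma walk_reversal: "walk *v (reflection *v (walk *v f)) = reflection *v f"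
  by (simp only: walk_vec reflection_involution involution_vec)

lemma walk_power_reversal:
  "matrix_power walk n *v (reflection *v (matrix_power walk n *v f)) = reflection *v f"
proof (induction n)
  case 0
  show ?case by simp
next
  case (Suc n)
  \<comment> \<open>Splitting each power at its side next to \<open>R\<close> exposes \<open>U R U\<close>.\<close>
  have "matrix_power walk (Suc n) *v (reflection *v (matrix_power walk (Suc n) *v f))
      = matrix_power walk n *v (walk *v (reflection *v (walk *v (matrix_power walk n *v f))))"
    by (subst matrix_power_Suc_right)
      (simp only: matrix_power.simps matrix_vector_mul_assoc matrix_mul_assoc)
  then show ?case
    by (simp only: walk_reversal Suc.IH)
qed

text \<open>On the range of \<open>d\<^sup>*\<close>, which \<open>reflection\<close> fixes, reversibility turns transfer around.\<close>

lemma transfer_back: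
  assumes "matrix_power walk n *v (conj_transpose d *v u) = \<gamma> *s (conj_transpose d *v v)"
  shows "\<gamma> *s (matrix_power walk n *v (conj_transpose d *v v)) = conj_transpose d *v u"
  using walk_power_reversal[of n "conj_transpose d *v u"]
  by (simp only: assms vector_scalar_commute reflection_fixes_range)

text \<open>From \<open>d U = 2 P d - d S\<close> and \<open>d S U = d R = d\<close>: multiplying the first equation by \<open>U\<close>
  on the right gives the Chebyshev recurrence.\<close>

lemma boundary_walk_recurrence:
  "d *v (walk *v (walk *v f)) = 2 *s (disc *v (d *v (walk *v f))) - d *v f"
proof -
  have step: "d *v (walk *v g) = 2 *s (disc *v (d *v g)) - d *v (S *v g)" for g
    by (simp only: walk_vec reflection_vec matrix_vector_mult_diff_distrib vector_scalar_commute)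
      (simp only: matrix_vector_mul_assoc matrix_mul_assoc)
  have "d *v (S *v (walk *v f)) = d *v f"
    by (simp only: walk_vec involution_vec boundary_reflection)
  then show ?thesis by (simp only: step[of "walk *v f"])
qed

text \<open>This is \<open>d U\<^sup>n d\<^sup>* = T\<^sub>n(P)\<close>, tested against an eigenvector of \<open>P\<close>, where \<open>P\<close> acts as a
  scalar. The conjugate comes from the second argument of the form.\<close>

lemma herm_inner_walk:
  assumes "w \<in> eigenspace disc \<mu>"
  shows "herm_inner (d *v (matrix_power walk n *v (conj_transpose d *v v))) w
       = cnj (chebyshev_T n \<mu>) * herm_inner v w"
proof -
  have disc: "herm_inner (disc *v u) w = cnj \<mu> * herm_inner u w" for u
    using assms
    by (simp only: herm_inner_mult_left disc_self_adjoint eigenspace_def mem_Collect_eq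
        herm_inner_scale_right)
  have "herm_inner (d *v (matrix_power walk n *v (conj_transpose d *v v))) w
       = chebyshev_T n (cnj \<mu>) * herm_inner v w"
  proof (induction n "cnj \<mu>" rule: chebyshev_T.induct)
    case 1
    show ?case by (simp add: coisometry_vec)
  next
    case 2
    have "d *v (walk *v (conj_transpose d *v v)) = disc *v v"
      by (simp only: walk_vec reflection_fixes_range)
        (simp only: matrix_vector_mul_assoc matrix_mul_assoc)
    then show ?case by (simp add: disc)
  next
    case (3 n)
    let ?f = "matrix_power walk n *v (conj_transpose d *v v)"
    have "d *v (matrix_power walk (Suc (Suc n)) *v (conj_transpose d *v v))
        = 2 *s (disc *v (d *v (matrix_power walk (Suc n) *v (conj_transpose d *v v)))) - d *v ?f"
      using boundary_walk_recurrence[of ?f]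
      by (simp only: matrix_power.simps flip: matrix_vector_mul_assoc)
    then show ?case
      using 3 by (simp only: herm_inner_diff_left herm_inner_scale_left disc chebyshev_T.simps)
        (simp add: algebra_simps)
  qed
  then show ?thesis by (simp only: cnj_chebyshev_T)
qed

theorem chebyshev_T_of_transfer:
  assumes transfer:
      "matrix_power walk n *v (conj_transpose d *v u) = \<gamma> *s (conj_transpose d *v v)"
    and support: "\<mu> \<in> eigenvalue_support disc u"
  shows "chebyshev_T n \<mu> \<in> {1, -1}"
proof -
  define w where "w = orth_projection (eigenspace disc \<mu>) u"
  define t where "t = cnj (chebyshev_T n \<mu>)"
  have w: "w \<in> eigenspace disc \<mu>"
    unfolding w_def by (rule orth_projection_eigenspace)
  have "w \<noteq> 0" using support by (simp add: eigenvalue_support_def w_def)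
  then have nonzero: "herm_inner u w \<noteq> 0"
    unfolding w_def herm_inner_orth_projection_eigenspace by (simp add: herm_inner_self_eq_0_iff)
  have there: "t * herm_inner u w = \<gamma> * herm_inner v w"
    using herm_inner_walk[OF w, of n u]
    by (simp only: transfer vector_scalar_commute coisometry_vec herm_inner_scale_left t_def)
  have "herm_inner u w
      = herm_inner (d *v (\<gamma> *s (matrix_power walk n *v (conj_transpose d *v v)))) w"
    by (simp only: transfer_back[OF transfer] coisometry_vec)
  also have "\<dots> = \<gamma> * (t * herm_inner v w)"
    by (simp only: vector_scalar_commute herm_inner_scale_left herm_inner_walk[OF w] t_def)
  also have "\<dots> = t * (\<gamma> * herm_inner v w)"
    by (rule mult.left_commute)
  also have "\<dots> = t\<^sup>2 * herm_inner u w"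
    by (simp only: there[symmetric] power2_eq_square mult.assoc)
  finally have "t\<^sup>2 = 1" using nonzero by simp
  then have "cnj t \<in> {1, -1}" by (auto simp: power2_eq_1_iff)
  then show ?thesis by (simp add: t_def)
qed

end

text \<open>A vertex of degree 0 would give \<open>d\<close> a zero row, and \<open>d d\<^sup>*\<close> a zero on the diagonal. So
  connectedness and the second vertex enter here, through \<open>vertex_degree_pos\<close>.\<close>

lemma boundary_matrix_coisometry:
  fixes G :: "('v::finite, 'a::finite) pre_digraph"
  assumes "simple_connected_graph G" "2 \<le> CARD('v)"
  shows "boundary_matrix G ** conj_transpose (boundary_matrix G) = mat 1"
proof -
  interpret graph G using assms(1) by (simp add: simple_connected_graph_def)
  have arcs: "arcs G = UNIV" using assms(1) by (simp add: simple_connected_graph_def)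
  have "(boundary_matrix G ** conj_transpose (boundary_matrix G)) $ x $ z = mat 1 $ x $ z"
    (is "?l = _") for x z
  proof (cases "x = z")
    case True
    have "?l = (\<Sum>a\<in>UNIV. if x = head G a then complex_of_real (1 / real (vertex_degree G x)) else 0)"
      unfolding True
      by (auto simp: matrix_matrix_mult_def boundary_matrix_def conj_transpose_def
          simp flip: of_real_mult intro!: sum.cong)
    also have "\<dots> = (\<Sum>a\<in>in_arcs G x. complex_of_real (1 / real (vertex_degree G x)))"
      by (rule sum.mono_neutral_cong_right) (auto simp: arcs)
    also have "\<dots> = 1"
      using vertex_degree_pos[OF assms, of x]
      by (auto simp: vertex_degree_eq_in_degree in_degree_def card_gt_0_iff)
    finally show ?thesis using True by (simp add: mat_def)
  next
    case False
    then show ?thesis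
      by (auto simp: matrix_matrix_mult_def boundary_matrix_def conj_transpose_def mat_def
          intro!: sum.neutral)
  qed
  then show ?thesis by (simp add: vec_eq_iff)
qed

lemma inv_arc_inv_arc:
  assumes "simple_connected_graph G"
  shows "inv_arc G (inv_arc G a) = a"
proof -
  interpret graph G using assms by (simp add: simple_connected_graph_def)
  have arcs: "a \<in> arcs G" for a using assms by (simp add: simple_connected_graph_def)
  show ?thesis
    by (rule no_multi_arcs) (auto simp: arcs arc_to_ends_def inv_arc)
qed

lemma shift_matrix_self_adjoint:
  assumes "simple_connected_graph G"
  shows "conj_transpose (shift_matrix G) = shift_matrix G"
proof -
  have "a = inv_arc G b \<longleftrightarrow> b = inv_arc G a" for a b
    using inv_arc_inv_arc[OF assms] by metis
  then show ?thesis by (simp add: conj_transpose_def shift_matrix_def vec_eq_iff)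
qed

lemma shift_matrix_involution:
  assumes "simple_connected_graph G"
  shows "shift_matrix G ** shift_matrix G = mat 1"
proof -
  have "(\<Sum>c\<in>UNIV. (if a = inv_arc G c then 1 else 0) * (if c = inv_arc G b then 1 else 0))
      = (if a = b then 1 else (0::complex))" for a b
    by (simp add: if_distrib[of "\<lambda>z. _ * z"] inv_arc_inv_arc[OF assms] cong: if_cong)
  then show ?thesis
    by (simp add: matrix_matrix_mult_def shift_matrix_def mat_def vec_eq_iff)
qed

theorem theorem1p1:
  fixes G :: "('v::finite, 'a::finite) pre_digraph"
    and x y :: 'v
    and \<tau> :: nat
  assumes "simple_connected_graph G"
    and "2 \<le> CARD('v)"
    and "perfect_state_transfer G
           (conj_transpose (boundary_matrix G) *v axis x 1)
           (conj_transpose (boundary_matrix G) *v axis y 1) \<tau>"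
  shows "\<forall>\<mu> \<in> eigenvalue_support (discriminant G) (axis x 1).
           chebyshev_T \<tau> \<mu> \<in> {1, -1}"
proof -
  interpret involutive_walk "boundary_matrix G" "shift_matrix G"
    by unfold_locales
      (use assms in \<open>simp_all add: boundary_matrix_coisometry shift_matrix_involution
        shift_matrix_self_adjoint\<close>)
  obtain \<gamma> where "matrix_power (grover_matrix G) \<tau> *v
      (conj_transpose (boundary_matrix G) *v axis x 1)
      = \<gamma> *s (conj_transpose (boundary_matrix G) *v axis y 1)"
    using assms(3) unfolding perfect_state_transfer_def by blast
  then show ?thesis
    using chebyshev_T_of_transfer unfolding grover_matrix_def discriminant_def by blast
qed

end
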